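(* Let $A$ be a finite-dimensional simple (not necessarily associative) algebra over an arbitrary field $F$, $\dim_F(A)=m$, let $V$ be the vector space of the multiplications of $A$ and let $R={\mathcal M}(A)$ be the algebra of multiplications of $A$. Let $c(x_1,\ldots,x_n)$ be a multilinear (non-trivial) central polynomial for the algebra ${\mathcal M}(A)$. Then the pair $(R,V)$ has a weak central polynomial of degree $\leq n(4m^2-m+1)$. If $A$ is a Lie or a Jordan algebra, then the pair $(R,V)$ has a weak central polynomial of degree $\leq n(m^2-m+1)$.
   Context: An algebra $A$ is simple if $A\cdot A\neq 0$ and $A$ has no two-sided ideals other than $0$ and $A$. For $a\in A$ let $\ell(a),r(a)\in\mathrm{End}_F(A)$ be the operators of left and right multiplication by $a$. The vector space of the multiplications $V\subseteq \mathrm{End}_F(A)$ is the span of all $\ell(a)$ and $r(a)$, $a\in A$, and the algebra of multiplications ${\mathcal M}(A)$ is the associative subalgebra of $\mathrm{End}_F(A)$ generated by $V$. Polynomials are elements of the free associative algebra over $F$. A polynomial $f(x_1,\ldots,x_n)$ is an identity for the pair $(R,V)$ if $f(v_1,\ldots,v_n)=0$ for all $v_i\in V$. A polynomial $c(x_1,\ldots,x_n)$ is a (weak, non-trivial) central polynomial for the pair $(R,V)$ if $c(v_1,\ldots,v_n)$ belongs to the center of $R$ for all $v_1,\ldots,v_n\in V$ and $c$ is not an identity for $(R,V)$. A (non-trivial) central polynomial of the algebra $R$ is a central polynomial for the pair $(R,R)$. Multilinear means linear in each of the variables $x_1,\ldots,x_n$. *)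

theory Defs
  imports Complex_Main "HOL-Library.Function_Algebras" "HOL-Library.Poly_Mapping"
begin

text \<open>The carrier of the algebra is the whole type \<open>'a\<close>; no unit and no associativity
  are assumed.\<close>

locale nonassoc_algebra = vector_space scl
  for scl :: "'f::field \<Rightarrow> 'a::ab_group_add \<Rightarrow> 'a" +
  fixes mul :: "'a \<Rightarrow> 'a \<Rightarrow> 'a"
  assumes linear_left_mult: "Vector_Spaces.linear scl scl (\<lambda>x. mul a x)"
    and linear_right_mult: "Vector_Spaces.linear scl scl (\<lambda>x. mul x a)"

definition two_sided_ideal ::
  "('f::field \<Rightarrow> 'a::ab_group_add \<Rightarrow> 'a) \<Rightarrow> ('a \<Rightarrow> 'a \<Rightarrow> 'a) \<Rightarrow> 'a set \<Rightarrow> bool" where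
  "two_sided_ideal scl mul I \<longleftrightarrow>
     module.subspace scl I \<and> (\<forall>a. \<forall>x\<in>I. mul a x \<in> I \<and> mul x a \<in> I)"

definition simple_algebra ::
  "('f::field \<Rightarrow> 'a::ab_group_add \<Rightarrow> 'a) \<Rightarrow> ('a \<Rightarrow> 'a \<Rightarrow> 'a) \<Rightarrow> bool" where
  "simple_algebra scl mul \<longleftrightarrow>
     (\<exists>a b. mul a b \<noteq> 0) \<and> (\<forall>I. two_sided_ideal scl mul I \<longrightarrow> I = {0} \<or> I = UNIV)"

text \<open>The next two predicates only state the defining identities; bilinearity comes from
  \<^locale>\<open>nonassoc_algebra\<close>.\<close>

definition lie_algebra :: "('a::ab_group_add \<Rightarrow> 'a \<Rightarrow> 'a) \<Rightarrow> bool" where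
  "lie_algebra mul \<longleftrightarrow>
     (\<forall>x. mul x x = 0) \<and>
     (\<forall>x y z. mul (mul x y) z + mul (mul y z) x + mul (mul z x) y = 0)"

definition jordan_algebra :: "('a \<Rightarrow> 'a \<Rightarrow> 'a) \<Rightarrow> bool" where
  "jordan_algebra mul \<longleftrightarrow>
     (\<forall>x y. mul x y = mul y x) \<and>
     (\<forall>x y. mul (mul (mul x x) y) x = mul (mul x x) (mul y x))"

text \<open>Endomorphisms are functions \<open>'a \<Rightarrow> 'a\<close> with pointwise addition, the pointwise scalar
  multiplication below, and composition as product.\<close>

definition fun_scale :: "('f \<Rightarrow> 'a \<Rightarrow> 'a) \<Rightarrow> 'f \<Rightarrow> ('a \<Rightarrow> 'a) \<Rightarrow> ('a \<Rightarrow> 'a)" where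
  "fun_scale scl c g = (\<lambda>x. scl c (g x))"

definition End_space :: "('f::field \<Rightarrow> 'a::ab_group_add \<Rightarrow> 'a) \<Rightarrow> ('a \<Rightarrow> 'a) set" where
  "End_space scl = {g. Vector_Spaces.linear scl scl g}"

definition mult_space ::
  "('f::field \<Rightarrow> 'a::ab_group_add \<Rightarrow> 'a) \<Rightarrow> ('a \<Rightarrow> 'a \<Rightarrow> 'a) \<Rightarrow> ('a \<Rightarrow> 'a) set" where
  "mult_space scl mul =
     module.span (fun_scale scl) (range (\<lambda>a x. mul a x) \<union> range (\<lambda>a x. mul x a))"

text \<open>Subalgebras are not required to contain the identity map.\<close>

definition End_subalgebra ::
  "('f::field \<Rightarrow> 'a::ab_group_add \<Rightarrow> 'a) \<Rightarrow> ('a \<Rightarrow> 'a) set \<Rightarrow> bool" where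
  "End_subalgebra scl S \<longleftrightarrow>
     S \<subseteq> End_space scl \<and> module.subspace (fun_scale scl) S \<and>
     (\<forall>g\<in>S. \<forall>h\<in>S. g \<circ> h \<in> S)"

definition mult_algebra ::
  "('f::field \<Rightarrow> 'a::ab_group_add \<Rightarrow> 'a) \<Rightarrow> ('a \<Rightarrow> 'a \<Rightarrow> 'a) \<Rightarrow> ('a \<Rightarrow> 'a) set" where
  "mult_algebra scl mul = End_subalgebra scl hull mult_space scl mul"

text \<open>The free monoid on \<open>'v\<close>, written additively because \<open>poly_mapping\<close> builds monoid
  algebras over additive monoids.  \<open>nat word \<Rightarrow>\<^sub>0 'f\<close>, with the multiplication of
  \<open>poly_mapping\<close>, is the unital free associative algebra on the variables \<open>x\<^sub>i\<close>, \<open>i :: nat\<close>.\<close>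

datatype 'v word = Word (letters: "'v list")

instantiation word :: (type) monoid_add
begin

definition zero_word :: "'a word" where "0 = Word []"

definition plus_word :: "'a word \<Rightarrow> 'a word \<Rightarrow> 'a word" where
  "u + w = Word (letters u @ letters w)"

instance
  by standard (simp_all add: zero_word_def plus_word_def)

end

type_synonym 'f ncpoly = "nat word \<Rightarrow>\<^sub>0 'f"

text \<open>The free associative algebra is taken without unit, i.e. polynomials have no constant
  term; otherwise the constant \<open>1\<close> would be a central polynomial of degree \<open>0\<close>
  whenever \<open>R\<close> contains the identity map.\<close>

definition free_assoc_algebra :: "'f::field ncpoly set" where
  "free_assoc_algebra = {f. Poly_Mapping.lookup f 0 = 0}"

definition total_degree :: "'f::field ncpoly \<Rightarrow> nat" where
  "total_degree f = Max (insert 0 ((\<lambda>w. length (letters w)) ` Poly_Mapping.keys f))"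

text \<open>Linearity in \<open>x\<^sub>i\<close> is read off the monomials: each of them contains \<open>x\<^sub>i\<close> exactly once.\<close>

definition multilinear :: "nat \<Rightarrow> 'f::field ncpoly \<Rightarrow> bool" where
  "multilinear n f \<longleftrightarrow>
     (\<forall>w\<in>Poly_Mapping.keys f.
        set (letters w) \<subseteq> {1..n} \<and> (\<forall>i\<in>{1..n}. count_list (letters w) i = 1))"

definition word_eval :: "(nat \<Rightarrow> 'a \<Rightarrow> 'a) \<Rightarrow> nat word \<Rightarrow> 'a \<Rightarrow> 'a" where
  "word_eval v w = foldr (\<lambda>i g. v i \<circ> g) (letters w) id"

definition ncpoly_eval ::
  "('f::field \<Rightarrow> 'a::ab_group_add \<Rightarrow> 'a) \<Rightarrow> (nat \<Rightarrow> 'a \<Rightarrow> 'a) \<Rightarrow> 'f ncpoly \<Rightarrow> 'a \<Rightarrow> 'a" where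
  "ncpoly_eval scl v f =
     (\<Sum>w\<in>Poly_Mapping.keys f. fun_scale scl (Poly_Mapping.lookup f w) (word_eval v w))"

definition center :: "('a \<Rightarrow> 'a) set \<Rightarrow> ('a \<Rightarrow> 'a) set" where
  "center R = {z\<in>R. \<forall>g\<in>R. z \<circ> g = g \<circ> z}"

text \<open>All variables \<open>x\<^sub>i\<close>, \<open>i :: nat\<close>, are assigned values in \<open>V\<close>; those not occurring in
  the polynomial have no influence.  Being an identity does not depend on the algebra \<open>R\<close>.\<close>

definition pair_identity ::
  "('f::field \<Rightarrow> 'a::ab_group_add \<Rightarrow> 'a) \<Rightarrow> ('a \<Rightarrow> 'a) set \<Rightarrow> 'f ncpoly \<Rightarrow> bool" where
  "pair_identity scl V f \<longleftrightarrow> (\<forall>v. (\<forall>i. v i \<in> V) \<longrightarrow> ncpoly_eval scl v f = 0)"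

definition central_polynomial ::
  "('f::field \<Rightarrow> 'a::ab_group_add \<Rightarrow> 'a) \<Rightarrow> ('a \<Rightarrow> 'a) set \<Rightarrow> ('a \<Rightarrow> 'a) set \<Rightarrow> 'f ncpoly \<Rightarrow> bool"
  where
  "central_polynomial scl R V c \<longleftrightarrow>
     c \<in> free_assoc_algebra \<and>
     (\<forall>v. (\<forall>i. v i \<in> V) \<longrightarrow> ncpoly_eval scl v c \<in> center R) \<and>
     \<not> pair_identity scl V c"

end

theory Submission
  imports Defs "HOL-Library.Nat_Bijection"
begin

text \<open>Let \<open>W\<^sub>k\<close> be the span of the products of at most \<open>k\<close> elements of \<open>V\<close>. As soon as
  \<open>W\<^sub>k = W\<^sub>k\<^sub>+\<^sub>1\<close>, the space \<open>W\<^sub>k\<close> is closed under multiplication and equals \<open>R\<close>; counting dimensions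
  inside \<open>End\<^sub>F(A)\<close>, this happens for some \<open>k \<le> m\<^sup>2 - dim V + 1\<close>. By multilinearity, \<open>c\<close> does not
  vanish at some choice of products of at most \<open>k\<close> elements of \<open>V\<close>, so replacing the variables of \<open>c\<close>
  by monomials of these lengths in fresh variables gives a weak central polynomial of degree at
  most \<open>n k\<close>. For Lie and Jordan algebras the annihilator of \<open>A\<close> is an ideal, hence zero, so left
  multiplication embeds \<open>A\<close> into \<open>V\<close> and \<open>dim V \<ge> m\<close>; in general the trivial bound \<open>dim V \<ge> 0\<close>
  suffices.\<close>

section \<open>Products of maps and substitution of monomials for variables\<close>

definition comp_list :: "('a \<Rightarrow> 'a) list \<Rightarrow> 'a \<Rightarrow> 'a" where
  "comp_list gs = foldr (\<circ>) gs id"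

lemma comp_list_simps [simp]:
  "comp_list [] = id" "comp_list (g # gs) = g \<circ> comp_list gs"
  by (simp_all add: comp_list_def)

lemma comp_list_append: "comp_list (gs @ hs) = comp_list gs \<circ> comp_list hs"
  by (induction gs) (simp_all add: comp_assoc)

lemma comp_list_concat: "comp_list (concat gss) = comp_list (map comp_list gss)"
  by (induction gss) (simp_all add: comp_list_append)

lemma word_eval_eq_comp_list: "word_eval v w = comp_list (map v (letters w))"
  by (simp add: word_eval_def comp_list_def foldr_map o_def[of "(\<circ>)" v])

definition word_subst :: "('u \<Rightarrow> 'v list) \<Rightarrow> 'u word \<Rightarrow> 'v word" where
  "word_subst b w = Word (concat (map b (letters w)))"

text \<open>Summing \<open>single\<close> terms adds up the coefficients of different words that the
  substitution sends to the same word.\<close>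

definition ncpoly_subst :: "(nat \<Rightarrow> nat list) \<Rightarrow> 'f::field ncpoly \<Rightarrow> 'f ncpoly" where
  "ncpoly_subst b f =
     (\<Sum>w\<in>Poly_Mapping.keys f. Poly_Mapping.single (word_subst b w) (Poly_Mapping.lookup f w))"

lemma word_eval_subst:
  "word_eval v (word_subst b w) = word_eval (\<lambda>i. comp_list (map v (b i))) w"
  by (simp add: word_eval_eq_comp_list word_subst_def map_concat comp_list_concat comp_def)

text \<open>Only an inclusion, because coefficients of words that become equal may cancel.\<close>

lemma keys_ncpoly_subst:
  "Poly_Mapping.keys (ncpoly_subst b f) \<subseteq> word_subst b ` Poly_Mapping.keys f"
proof -
  have "Poly_Mapping.keys (ncpoly_subst b f) \<subseteq> (\<Union>w\<in>Poly_Mapping.keys f.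
      Poly_Mapping.keys (Poly_Mapping.single (word_subst b w) (Poly_Mapping.lookup f w)))"
    unfolding ncpoly_subst_def by (rule keys_sum)
  also have "\<dots> \<subseteq> word_subst b ` Poly_Mapping.keys f"
    by (auto split: if_splits)
  finally show ?thesis .
qed

text \<open>The length of a word is the sum of its letter counts, here n ones.\<close>

lemma multilinear_length:
  assumes "multilinear n f" "w \<in> Poly_Mapping.keys f"
  shows "length (letters w) = n"
proof -
  have s: "set (letters w) \<subseteq> {1..n}" and c: "\<And>i. i \<in> {1..n} \<Longrightarrow> count_list (letters w) i = 1"
    using assms by (auto simp: multilinear_def)
  have "length (letters w) = (\<Sum>i\<in>{1..n}. count_list (letters w) i)"
    using s by (simp add: sum_count_set)
  also have "\<dots> = n"
    using c by simp
  finally show ?thesis .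
qed

lemma total_degree_ncpoly_subst:
  assumes "multilinear n f" and "\<And>i. length (b i) \<le> k"
  shows "total_degree (ncpoly_subst b f) \<le> n * k"
proof -
  have "length (letters (word_subst b w)) \<le> n * k" if "w \<in> Poly_Mapping.keys f" for w
  proof -
    have "length (letters (word_subst b w)) \<le> length (letters w) * k"
      using sum_list_mono[of "letters w" "\<lambda>i. length (b i)" "\<lambda>_. k"] assms(2)
      by (simp add: word_subst_def length_concat comp_def sum_list_triv)
    then show ?thesis
      using multilinear_length[OF assms(1) that] by simp
  qed
  then show ?thesis
    using keys_ncpoly_subst[of b f] unfolding total_degree_def
    by (subst Max_le_iff) auto
qed

text \<open>A nonempty word stays nonempty when each letter is replaced by a nonempty list, so no
  constant term arises.\<close>

lemma ncpoly_subst_in_free_assoc_algebra: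
  assumes "f \<in> free_assoc_algebra" and "\<And>i. b i \<noteq> []"
  shows "ncpoly_subst b f \<in> free_assoc_algebra"
proof -
  have "word_subst b w \<noteq> 0" if "w \<in> Poly_Mapping.keys f" for w
  proof -
    have "w \<noteq> 0"
      using that assms(1) by (auto simp: free_assoc_algebra_def in_keys_iff)
    then obtain i ls where "letters w = i # ls"
      by (cases w; cases "letters w") (auto simp: zero_word_def)
    then show ?thesis
      using assms(2)[of i] by (simp add: word_subst_def zero_word_def)
  qed
  then have "0 \<notin> Poly_Mapping.keys (ncpoly_subst b f)"
    using keys_ncpoly_subst[of b f] by force
  then show ?thesis
    by (simp add: free_assoc_algebra_def in_keys_iff)
qed

section \<open>The linear structure on maps and products of bounded length\<close>

lemma sum_apply_fun: "(\<Sum>i\<in>I. h i) x = (\<Sum>i\<in>I. h i x)"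
  by (induction I rule: infinite_finite_induct) simp_all

lemma vector_space_fun_scale:
  assumes "vector_space scl"
  shows "vector_space (fun_scale scl)"
proof -
  interpret vector_space scl by fact
  show ?thesis
    by standard (auto simp: fun_scale_def fun_eq_iff scale_right_distrib scale_left_distrib)
qed

text \<open>The empty product is excluded: the identity map need not be a combination of products of
  multiplications a priori, and monomials substituted later must not be constant.\<close>

definition prods :: "('a \<Rightarrow> 'a) set \<Rightarrow> nat \<Rightarrow> ('a \<Rightarrow> 'a) set" where
  "prods V k = {comp_list gs | gs. gs \<noteq> [] \<and> set gs \<subseteq> V \<and> length gs \<le> k}"

lemma prods_mono: "j \<le> k \<Longrightarrow> prods V j \<subseteq> prods V k"
  by (fastforce simp: prods_def)

lemma in_prods_1: "g \<in> V \<Longrightarrow> 1 \<le> k \<Longrightarrow> g \<in> prods V k"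
  unfolding prods_def by (intro CollectI exI[of _ "[g]"]) simp

lemma comp_in_prods_Suc: "g \<in> V \<Longrightarrow> h \<in> prods V k \<Longrightarrow> g \<circ> h \<in> prods V (Suc k)"
proof -
  assume "g \<in> V" "h \<in> prods V k"
  then obtain gs where "h = comp_list gs" "set gs \<subseteq> V" "length gs \<le> k"
    by (auto simp: prods_def)
  with \<open>g \<in> V\<close> show ?thesis
    unfolding prods_def by (intro CollectI exI[of _ "g # gs"]) simp
qed

section \<open>Evaluation of polynomials at linear maps\<close>

context vector_space
begin

interpretation endo: vector_space "fun_scale scale"
  by (rule vector_space_fun_scale) (rule vector_space_axioms)

text \<open>Words outside the support have coefficient 0. This allows polynomials with different
  supports to be evaluated over one common finite set of words.\<close>

lemma ncpoly_eval_superset: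
  assumes "finite K" "Poly_Mapping.keys f \<subseteq> K"
  shows "ncpoly_eval scale v f =
    (\<Sum>w\<in>K. fun_scale scale (Poly_Mapping.lookup f w) (word_eval v w))"
  unfolding ncpoly_eval_def using assms
  by (intro sum.mono_neutral_left) (auto simp: in_keys_iff)

lemma ncpoly_eval_add: "ncpoly_eval scale v (f + g) = ncpoly_eval scale v f + ncpoly_eval scale v g"
proof -
  let ?K = "Poly_Mapping.keys f \<union> Poly_Mapping.keys g"
  have "ncpoly_eval scale v h = (\<Sum>w\<in>?K. fun_scale scale (Poly_Mapping.lookup h w) (word_eval v w))"
    if "h \<in> {f, g, f + g}" for h
    using that Poly_Mapping.keys_add[of f g] by (intro ncpoly_eval_superset) auto
  then show ?thesis
    by (simp add: lookup_add endo.scale_left_distrib sum.distrib)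
qed

lemma ncpoly_eval_single:
  "ncpoly_eval scale v (Poly_Mapping.single w a) = fun_scale scale a (word_eval v w)"
  using ncpoly_eval_superset[of "{w}" "Poly_Mapping.single w a" v] by simp

lemma ncpoly_eval_0: "ncpoly_eval scale v 0 = 0"
  by (simp add: ncpoly_eval_def)

lemma ncpoly_eval_sum: "ncpoly_eval scale v (sum p K) = (\<Sum>x\<in>K. ncpoly_eval scale v (p x))"
  by (induction K rule: infinite_finite_induct) (simp_all add: ncpoly_eval_add ncpoly_eval_0)

lemma ncpoly_eval_subst:
  "ncpoly_eval scale v (ncpoly_subst b f) = ncpoly_eval scale (\<lambda>i. comp_list (map v (b i))) f"
  unfolding ncpoly_subst_def ncpoly_eval_sum ncpoly_eval_single word_eval_subst
  by (simp add: ncpoly_eval_def)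

lemma End_space_iff:
  "g \<in> End_space scale \<longleftrightarrow>
     (\<forall>x y. g (x + y) = g x + g y) \<and> (\<forall>a x. g (scale a x) = scale a (g x))"
  using vector_space_axioms
  by (auto simp: End_space_def Vector_Spaces.linear_def module_hom_def module_hom_axioms_def
      module_iff_vector_space)

lemma End_subalgebra_End_space: "End_subalgebra scale (End_space scale)"
  unfolding End_subalgebra_def endo.subspace_def
  by (auto simp: End_space_iff fun_scale_def algebra_simps scale_left_commute)

lemma comp_list_in_End_space:
  "set gs \<subseteq> End_space scale \<Longrightarrow> comp_list gs \<in> End_space scale"
  by (induction gs) (auto simp: End_space_iff)

lemma comp_add_right: "g \<in> End_space scale \<Longrightarrow> g \<circ> (x + y) = (g \<circ> x) + (g \<circ> y)"
  by (auto simp: End_space_iff fun_eq_iff)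

lemma comp_scale_right: "g \<in> End_space scale \<Longrightarrow> g \<circ> fun_scale scale a x = fun_scale scale a (g \<circ> x)"
  by (auto simp: End_space_iff fun_scale_def)

text \<open>Composing with \<open>g\<close> on the left respects sums and scalars because
  \<open>g\<close> itself is linear.\<close>

lemma comp_in_span_right:
  assumes "g \<in> End_space scale" "\<And>x. x \<in> S \<Longrightarrow> g \<circ> x \<in> endo.span T" "h \<in> endo.span S"
  shows "g \<circ> h \<in> endo.span T"
  using assms(3)
proof (induction rule: endo.span_induct_alt)
  case base
  have "g \<circ> 0 = (0 :: 'b \<Rightarrow> 'b)"
    using comp_scale_right[OF assms(1), of 0 0] by (simp only: endo.scale_zero_left)
  then show ?case
    by (simp only: endo.span_zero)
next
  case (step a x y)
  have "g \<circ> (fun_scale scale a x + y) = fun_scale scale a (g \<circ> x) + (g \<circ> y)"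
    using assms(1) by (simp only: comp_add_right comp_scale_right)
  then show ?case
    using step assms(2) by (simp only: endo.span_add endo.span_scale)
qed

text \<open>Composing with \<open>h\<close> on the right is linear because the operations on maps
  are pointwise.\<close>

lemma comp_in_span_left:
  assumes "\<And>x. x \<in> S \<Longrightarrow> x \<circ> h \<in> endo.span T" "g \<in> endo.span S"
  shows "g \<circ> h \<in> endo.span T"
  using assms(2)
proof (induction rule: endo.span_induct_alt)
  case base
  then show ?case
    using endo.span_zero[of T] by (simp add: comp_def zero_fun_def)
next
  case (step a x y)
  have eq: "(fun_scale scale a x + y) \<circ> h = fun_scale scale a (x \<circ> h) + (y \<circ> h)"
    by (simp add: fun_eq_iff fun_scale_def)
  show ?case
    unfolding eq using step assms(1) by (intro endo.span_add endo.span_scale)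
qed

section \<open>Multilinear polynomials on spanning sets\<close>

lemma word_eval_update:
  assumes "count_list (letters w) i = 1" "\<And>j. v j \<in> End_space scale"
  obtains g h where "g \<in> End_space scale" "\<And>x. word_eval (v(i := x)) w = g \<circ> x \<circ> h"
proof -
  have "i \<in> set (letters w)"
    using assms(1) count_notin[of i "letters w"] by force
  \<comment> \<open>The word is split at its only occurrence of \<open>i\<close>; neither outer part
    then sees the new value.\<close>
  then obtain us ws where s: "letters w = us @ i # ws" "i \<notin> set us"
    by (meson split_list_first)
  with assms(1) have "i \<notin> set ws"
    by (simp add: count_list_0_iff)
  with s have "word_eval (v(i := x)) w = comp_list (map v us) \<circ> x \<circ> comp_list (map v ws)" for x
    by (simp add: word_eval_eq_comp_list comp_list_append comp_assoc)
  moreover have "comp_list (map v us) \<in> End_space scale"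
    using assms(2) by (intro comp_list_in_End_space) auto
  ultimately show ?thesis
    using that by blast
qed

text \<open>Each monomial takes the form g x h with \<open>g\<close> linear, hence is linear in x;
  the sum inherits this.\<close>

lemma ncpoly_eval_update_linear:
  assumes "multilinear n f" "i \<in> {1..n}" "\<And>j. v j \<in> End_space scale"
  defines "e \<equiv> \<lambda>x. ncpoly_eval scale (v(i := x)) f"
  shows "e (x + y) = e x + e y" "e (fun_scale scale a x) = fun_scale scale a (e x)"
proof -
  have *: "word_eval (v(i := x + y)) w = word_eval (v(i := x)) w + word_eval (v(i := y)) w \<and>
      word_eval (v(i := fun_scale scale a x)) w = fun_scale scale a (word_eval (v(i := x)) w)"
    if w: "w \<in> Poly_Mapping.keys f" for w
  proof -
    have "count_list (letters w) i = 1"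
      using assms(1,2) w by (auto simp: multilinear_def)
    then obtain g h where "g \<in> End_space scale" "\<And>x. word_eval (v(i := x)) w = g \<circ> x \<circ> h"
      using word_eval_update assms(3) by blast
    then show ?thesis
      by (auto simp: End_space_iff fun_scale_def)
  qed
  show "e (x + y) = e x + e y"
    unfolding e_def ncpoly_eval_def sum.distrib[symmetric]
    by (intro sum.cong refl) (simp add: * endo.scale_right_distrib)
  show "e (fun_scale scale a x) = fun_scale scale a (e x)"
    unfolding e_def ncpoly_eval_def endo.scale_sum_right
    by (intro sum.cong refl) (simp add: * mult.commute)
qed

text \<open>The arguments of a nonzero value are moved from \<open>R\<close> into the spanning set
  \<open>P\<close> one variable at a time.\<close>

lemma multilinear_nonzero_on_spanning_set:
  assumes f: "multilinear n f" and R: "R \<subseteq> End_space scale" "P \<subseteq> R" "R \<subseteq> endo.span P"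
    and p: "p \<in> P" and f0: "\<not> pair_identity scale R f"
  obtains v where "\<And>i. v i \<in> P" "ncpoly_eval scale v f \<noteq> 0"
proof -
  have "\<exists>v. (\<forall>i\<in>{1..k}. v i \<in> P) \<and> (\<forall>i. v i \<in> R) \<and> ncpoly_eval scale v f \<noteq> 0"
    if "k \<le> n" for k
    using that
  proof (induction k)
    case 0
    obtain v where "\<forall>i. v i \<in> R" "ncpoly_eval scale v f \<noteq> 0"
      using f0 unfolding pair_identity_def by blast
    moreover have "\<forall>i\<in>{1..0}. v i \<in> P"
      by simp
    ultimately show ?case
      by blast
  next
    case (Suc k)
    then obtain v where v: "\<And>i. i \<in> {1..k} \<Longrightarrow> v i \<in> P" "\<And>i. v i \<in> R"
      and v0: "ncpoly_eval scale v f \<noteq> 0"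
      by (metis Suc_leD)
    define e where "e x = ncpoly_eval scale (v(Suc k := x)) f" for x
    have lin: "e (x + y) = e x + e y" "e (fun_scale scale a x) = fun_scale scale a (e x)" for x y a
      unfolding e_def using Suc.prems v(2) R(1)
      by (intro ncpoly_eval_update_linear[OF f]; auto)+
    \<comment> \<open>Otherwise the linear map \<open>e\<close> would vanish on the span of
      \<open>P\<close>, hence at the old value \<open>v (Suc k)\<close>.\<close>
    have "\<exists>x\<in>P. e x \<noteq> 0"
    proof (rule ccontr)
      assume "\<not> ?thesis"
      then have e0: "e x = 0" if "x \<in> P" for x
        using that by blast
      have "e x = 0" if "x \<in> endo.span P" for x
        using that
      proof (induction rule: endo.span_induct_alt)
        case base
        show ?case
          using lin(2)[of 0 0] by (simp only: endo.scale_zero_left)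
      next
        case (step a x y)
        then show ?case
          using e0 by (simp only: lin) simp
      qed
      moreover have "e (v (Suc k)) = ncpoly_eval scale v f"
        by (simp add: e_def)
      ultimately show False
        using v(2)[of "Suc k"] v0 subsetD[OF R(3)] by metis
    qed
    then obtain x where x: "x \<in> P" "e x \<noteq> 0"
      by blast
    have "\<forall>i\<in>{1..Suc k}. (v(Suc k := x)) i \<in> P" "\<forall>i. (v(Suc k := x)) i \<in> R"
      using v x(1) R(2) by (auto simp: le_Suc_eq)
    with x(2) show ?case
      unfolding e_def by blast
  qed
  then obtain v where v: "\<And>i. i \<in> {1..n} \<Longrightarrow> v i \<in> P" "ncpoly_eval scale v f \<noteq> 0"
    by blast
  \<comment> \<open>Variables outside \<open>{1..n}\<close> do not occur in \<open>f\<close>; the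
    default \<open>p\<close> puts their values into \<open>P\<close> as well.\<close>
  define v' where "v' i = (if i \<in> {1..n} then v i else p)" for i
  have "word_eval v' w = word_eval v w" if "w \<in> Poly_Mapping.keys f" for w
  proof -
    have "set (letters w) \<subseteq> {1..n}"
      using f that by (auto simp: multilinear_def)
    then have "map v' (letters w) = map v (letters w)"
      unfolding v'_def by (intro map_cong refl) auto
    then show ?thesis
      by (simp only: word_eval_eq_comp_list)
  qed
  then have "ncpoly_eval scale v' f = ncpoly_eval scale v f"
    unfolding ncpoly_eval_def by (intro sum.cong refl) simp
  then show ?thesis
    using v p that[of v'] by (auto simp: v'_def)
qed

section \<open>The generated subalgebra and stabilization of products\<close>

lemma hull_End_subalgebra:
  assumes "V \<subseteq> End_space scale"
  shows "End_subalgebra scale (End_subalgebra scale hull V)"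
proof -
  \<comment> \<open>The hull is an intersection of subalgebras; \<open>End_space\<close> is a member
    of the family, so the intersection consists of linear maps.\<close>
  have "End_subalgebra scale hull V \<subseteq> End_space scale"
    using assms by (intro hull_minimal End_subalgebra_End_space)
  then show ?thesis
    unfolding End_subalgebra_def hull_def endo.subspace_def by blast
qed

lemma prods_subset_End_subalgebra:
  assumes "End_subalgebra scale R" "V \<subseteq> R"
  shows "prods V k \<subseteq> R"
proof -
  have "comp_list gs \<in> R" if "gs \<noteq> []" "set gs \<subseteq> V" for gs
    using that
  proof (induction gs rule: list_nonempty_induct)
    case (cons g gs)
    then show ?case
      using assms unfolding End_subalgebra_def comp_list_simps by (metis list.set_intros subset_eq)
  qed (use assms in auto)
  then show ?thesis
    by (auto simp: prods_def)
qed

text \<open>By stability the span is closed under left multiplication by \<open>V\<close>, then by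
  products of elements of \<open>V\<close>, then by their linear combinations. It is therefore a
  subalgebra containing \<open>V\<close>.\<close>

lemma hull_subset_span_prods:
  assumes V: "V \<subseteq> End_space scale" and k: "1 \<le> k"
    and stable: "prods V (Suc k) \<subseteq> endo.span (prods V k)"
  shows "End_subalgebra scale hull V \<subseteq> endo.span (prods V k)"
proof (rule hull_minimal)
  let ?W = "endo.span (prods V k)"
  show "V \<subseteq> ?W"
    using in_prods_1[OF _ k] endo.span_base by blast
  have V_mult: "g \<circ> h \<in> ?W" if "g \<in> V" "h \<in> ?W" for g h
  proof (rule comp_in_span_right)
    show "g \<in> End_space scale"
      using that(1) V by (rule subsetD[rotated])
    show "g \<circ> x \<in> ?W" if "x \<in> prods V k" for x
      using comp_in_prods_Suc[OF \<open>g \<in> V\<close> that] by (rule subsetD[OF stable])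
  qed fact
  have "comp_list gs \<circ> h \<in> ?W" if "set gs \<subseteq> V" "h \<in> ?W" for gs h
    using that by (induction gs) (simp_all add: comp_assoc V_mult del: o_apply)
  then have prods_mult: "g \<circ> h \<in> ?W" if "g \<in> prods V k" "h \<in> ?W" for g h
    using that by (auto simp: prods_def)
  have "g \<circ> h \<in> ?W" if "g \<in> ?W" "h \<in> ?W" for g h
    by (rule comp_in_span_left[OF prods_mult[OF _ that(2)] that(1)])
  moreover have "?W \<subseteq> End_space scale"
    using End_subalgebra_End_space prods_subset_End_subalgebra V
    by (intro endo.span_minimal) (auto simp: End_subalgebra_def)
  ultimately show "End_subalgebra scale ?W"
    by (simp add: End_subalgebra_def)
qed

text \<open>Every step that does not stabilize adds an independent element to \<open>B\<close>, and
  \<open>N\<close> bounds the size of independent sets.\<close>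

lemma prods_stabilize:
  assumes B: "B \<subseteq> V" "finite B" "endo.independent B" and V: "V \<subseteq> End_space scale"
    and bound: "\<And>S. S \<subseteq> End_space scale \<Longrightarrow> endo.independent S \<Longrightarrow> finite S \<and> card S \<le> N"
  obtains k where "1 \<le> k" "k \<le> N - card B + 1" "prods V (Suc k) \<subseteq> endo.span (prods V k)"
proof -
  have grow: "(\<exists>j. 1 \<le> j \<and> j \<le> k \<and> prods V (Suc j) \<subseteq> endo.span (prods V j)) \<or>
      (\<exists>S. S \<subseteq> prods V (Suc k) \<and> finite S \<and> endo.independent S \<and> card S = card B + k)" for k
  proof (induction k)
    case 0
    \<comment> \<open>For k = 0 the set is \<open>B\<close> itself, made of products of length
      1.\<close>
    then show ?case
      using B in_prods_1[of _ V "Suc 0"] by (intro disjI2 exI[of _ B]) auto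
  next
    case (Suc k)
    show ?case
    proof (cases "prods V (Suc (Suc k)) \<subseteq> endo.span (prods V (Suc k))
        \<or> (\<exists>j. 1 \<le> j \<and> j \<le> k \<and> prods V (Suc j) \<subseteq> endo.span (prods V j))")
      case True
      then show ?thesis
        by (metis le_SucI le_refl One_nat_def Suc_le_mono le0)
    next
      case False
      with Suc.IH obtain S where S: "S \<subseteq> prods V (Suc k)" "finite S" "endo.independent S"
          "card S = card B + k"
        by blast
      \<comment> \<open>A product outside the span of all shorter ones is independent of
        \<open>S\<close>, which consists of shorter ones.\<close>
      from False obtain g where g: "g \<in> prods V (Suc (Suc k))" "g \<notin> endo.span (prods V (Suc k))"
        by blast
      then have "g \<notin> endo.span S"
        using endo.span_mono[OF S(1)] by blast
      moreover from this have "g \<notin> S"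
        using endo.span_base by blast
      moreover have "S \<subseteq> prods V (Suc (Suc k))"
        using S(1) prods_mono[of "Suc k" "Suc (Suc k)" V] by auto
      ultimately have "insert g S \<subseteq> prods V (Suc (Suc k)) \<and> finite (insert g S) \<and>
          endo.independent (insert g S) \<and> card (insert g S) = card B + Suc k"
        using S g by (simp add: endo.independent_insert)
      then show ?thesis
        by blast
    qed
  qed
  \<comment> \<open>The truncated subtraction is thus exact, and an independent set after
    \<open>N - card B + 1\<close> steps would have N + 1 elements.\<close>
  have "card B \<le> N"
    using bound[of B] B V by auto
  moreover have "prods V k \<subseteq> End_space scale" for k
    by (rule prods_subset_End_subalgebra[OF End_subalgebra_End_space V])
  ultimately have "\<not> (S \<subseteq> prods V (Suc (N - card B + 1)) \<and> finite S \<and> endo.independent S \<and>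
      card S = card B + (N - card B + 1))" for S
    using bound[of S] by fastforce
  then show ?thesis
    using grow[of "N - card B + 1"] that by blast
qed

section \<open>From a central polynomial of \<open>R\<close> to one of the pair of \<open>R\<close>
  and \<open>V\<close>\<close>

lemma central_polynomial_on_generators:
  assumes V: "V \<subseteq> End_space scale" "0 \<in> V" and R: "R = End_subalgebra scale hull V"
    and c: "multilinear n c" "central_polynomial scale R R c"
    and k: "1 \<le> k" "prods V (Suc k) \<subseteq> endo.span (prods V k)"
  obtains f where "central_polynomial scale R V f" "total_degree f \<le> n * k"
proof -
  have subalg: "End_subalgebra scale R"
    unfolding R by (rule hull_End_subalgebra) fact
  have VR: "V \<subseteq> R"
    unfolding R by (rule hull_subset)
  have PR: "prods V k \<subseteq> R"
    by (rule prods_subset_End_subalgebra) fact+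
  have span: "R \<subseteq> endo.span (prods V k)"
    unfolding R by (rule hull_subset_span_prods) fact+
  have "R \<subseteq> End_space scale" "\<not> pair_identity scale R c"
    using subalg c(2) by (simp_all add: End_subalgebra_def central_polynomial_def)
  with PR span obtain u where u: "\<And>i. u i \<in> prods V k" "ncpoly_eval scale u c \<noteq> 0"
    using multilinear_nonzero_on_spanning_set[OF c(1)] in_prods_1[OF V(2) k(1)] by metis
  then have "\<exists>gs. u i = comp_list gs \<and> gs \<noteq> [] \<and> set gs \<subseteq> V \<and> length gs \<le> k" for i
    by (auto simp: prods_def)
  then obtain gs where gs: "\<And>i. u i = comp_list (gs i)" "\<And>i. gs i \<noteq> []" "\<And>i. set (gs i) \<subseteq> V"
      "\<And>i. length (gs i) \<le> k"
    by metis
  \<comment> \<open>\<open>prod_encode\<close> gives every factor of every \<open>u i\<close> its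
    own variable, so all factors can be assigned independently.\<close>
  define b where "b i = map (\<lambda>j. prod_encode (i, j)) [0..<length (gs i)]" for i
  \<comment> \<open>The default 0 keeps the variables that encode no factor inside
    \<open>V\<close>.\<close>
  define v where "v x = (case prod_decode x of (i, j) \<Rightarrow> if j < length (gs i) then gs i ! j else 0)"
    for x
  let ?f = "ncpoly_subst b c"
  have b_ne: "b i \<noteq> []" for i
    using gs(2) by (simp add: b_def)
  have vV: "v x \<in> V" for x
    using gs(3) V(2) nth_mem by (fastforce simp: v_def split: prod.split)
  have "map v (b i) = gs i" for i
    by (intro nth_equalityI) (simp_all add: b_def v_def)
  then have "ncpoly_eval scale v ?f = ncpoly_eval scale u c"
    by (simp add: ncpoly_eval_subst gs(1)[symmetric])
  then have "\<not> pair_identity scale V ?f"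
    using u(2) vV unfolding pair_identity_def by metis
  \<comment> \<open>For any values in \<open>V\<close> the substituted monomials take values in
    \<open>R\<close>, where \<open>c\<close> is central.\<close>
  moreover have "ncpoly_eval scale w ?f \<in> center R" if "\<And>i. w i \<in> V" for w
  proof -
    have "comp_list (map w (b i)) \<in> R" for i
    proof -
      have "comp_list (map w (b i)) \<in> prods V (length (b i))"
        using that b_ne unfolding prods_def by (intro CollectI exI[of _ "map w (b i)"]) auto
      then show ?thesis
        using prods_subset_End_subalgebra[OF subalg VR] by blast
    qed
    then show ?thesis
      using c(2) by (simp add: ncpoly_eval_subst central_polynomial_def)
  qed
  moreover have "?f \<in> free_assoc_algebra"
    using c(2) b_ne by (intro ncpoly_subst_in_free_assoc_algebra) (auto simp: central_polynomial_def)
  ultimately have "central_polynomial scale R V ?f"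
    by (simp add: central_polynomial_def)
  moreover have "total_degree ?f \<le> n * k"
    using gs(4) by (intro total_degree_ncpoly_subst[OF c(1)]) (simp add: b_def)
  ultimately show ?thesis
    by (rule that)
qed

end

section \<open>The dimension of the endomorphism algebra\<close>

context finite_dimensional_vector_space
begin

interpretation endo: vector_space "fun_scale scale"
  by (rule vector_space_fun_scale) (rule vector_space_axioms)

lemma card_independent_End_le:
  assumes "S \<subseteq> End_space scale" "endo.independent S"
  shows "finite S \<and> card S \<le> (dim (UNIV :: 'b set))\<^sup>2"
proof -
  \<comment> \<open>The matrix units: \<open>E (b, b')\<close> sends \<open>b\<close> to
    \<open>b'\<close> and the other basis vectors to 0. They span the endomorphisms.\<close>
  define E where "E = (\<lambda>(b, b') x. scale (representation Basis x b) b')"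
  have rep: "x = (\<Sum>b\<in>Basis. scale (representation Basis x b) b)" for x
    using sum_representation_eq[OF independent_Basis, of x Basis] span_Basis finite_Basis by simp
  have "g \<in> endo.span (E ` (Basis \<times> Basis))" if "g \<in> S" for g
  proof -
    have "Vector_Spaces.linear scale scale g"
      using that assms(1) by (auto simp: End_space_def)
    then interpret g: Vector_Spaces.linear scale scale g .
    \<comment> \<open>The coefficients are the matrix entries of \<open>g\<close>, obtained by
      expanding first \<open>x\<close> and then each \<open>g b\<close> in the basis.\<close>
    have g_eq: "g x = (\<Sum>b\<in>Basis. \<Sum>b'\<in>Basis.
        fun_scale scale (representation Basis (g b) b') (E (b, b')) x)" for x
    proof -
      have "g x = (\<Sum>b\<in>Basis. scale (representation Basis x b) (g b))"
        by (subst rep[of x]) (simp add: g.sum g.scale)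
      also have "\<dots> = (\<Sum>b\<in>Basis. \<Sum>b'\<in>Basis.
          scale (representation Basis x b) (scale (representation Basis (g b) b') b'))"
        by (subst rep) (simp add: scale_sum_right)
      finally show ?thesis
        by (simp add: E_def fun_scale_def mult.commute)
    qed
    have "g = (\<Sum>b\<in>Basis. \<Sum>b'\<in>Basis.
        fun_scale scale (representation Basis (g b) b') (E (b, b')))"
      by (rule ext) (simp only: sum_apply_fun g_eq[symmetric])
    also have "\<dots> \<in> endo.span (E ` (Basis \<times> Basis))"
      by (intro endo.span_sum endo.span_scale endo.span_base) auto
    finally show ?thesis .
  qed
  then have "finite S \<and> card S \<le> card (E ` (Basis \<times> Basis))"
    using assms(2) finite_Basis by (intro endo.independent_span_bound) auto
  moreover have "card (E ` (Basis \<times> Basis)) \<le> (dim (UNIV :: 'b set))\<^sup>2"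
    using card_image_le[of "Basis \<times> Basis" E] finite_Basis
    by (simp add: card_cartesian_product dim_UNIV power2_eq_square)
  ultimately show ?thesis
    by linarith
qed

end

section \<open>Multiplication operators of the algebra\<close>

lemma (in nonassoc_algebra) mult_space_subset_End_space: "mult_space scl mul \<subseteq> End_space scl"
proof -
  interpret endo: vector_space "fun_scale scl"
    by (rule vector_space_fun_scale) (rule vector_space_axioms)
  show ?thesis
    unfolding mult_space_def using End_subalgebra_End_space linear_left_mult linear_right_mult
    by (intro endo.span_minimal) (auto simp: End_subalgebra_def End_space_def)
qed

text \<open>The kernel of left multiplication is a two-sided ideal, and it is not the whole algebra
  because some product is nonzero.\<close>

lemma (in nonassoc_algebra) left_mult_inj:
  assumes "simple_algebra scl mul" and "lie_algebra mul \<or> jordan_algebra mul"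
  shows "inj mul"
proof -
  have left: "mul a (x + y) = mul a x + mul a y" "mul a (scl s x) = scl s (mul a x)"
    and right: "mul (x + y) a = mul x a + mul y a" "mul (scl s x) a = scl s (mul x a)"
    for a x y s
    using linear_left_mult[of a] linear_right_mult[of a]
    unfolding mem_Collect_eq[of _ "Vector_Spaces.linear scl scl", symmetric] End_space_def[symmetric]
      End_space_iff by simp_all
  \<comment> \<open>Expanding the square of a + b gives anticommutativity in the Lie case; the
    Jordan case is commutative. This makes the left annihilator condition two-sided.\<close>
  have "mul b a = 0" if "mul a b = 0" for a b
    using assms(2)
  proof
    assume "lie_algebra mul"
    then have "mul (a + b) (a + b) = 0" "mul a a = 0" "mul b b = 0"
      unfolding lie_algebra_def by blast+
    then show ?thesis
      using that by (simp add: left(1) right(1))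
  next
    assume "jordan_algebra mul"
    then show ?thesis
      using that unfolding jordan_algebra_def by metis
  qed
  moreover have zero: "mul 0 x = 0" "mul x 0 = 0" for x
    using left(1)[of x 0 0] right(1)[of 0 0 x] by simp_all
  ultimately have "two_sided_ideal scl mul {a. \<forall>x. mul a x = 0}"
    unfolding two_sided_ideal_def by (auto simp: subspace_def right)
  then have ann: "{a. \<forall>x. mul a x = 0} = {0}"
    using assms(1) unfolding simple_algebra_def by blast
  show ?thesis
  proof (rule injI)
    fix a b
    assume eq: "mul a = mul b"
    have "mul (a - b) x = 0" for x
      using right(1)[of "a - b" b x] eq by simp
    with ann have "a - b \<in> {0}"
      by blast
    then show "a = b"
      by simp
  qed
qed

section \<open>The degree bounds\<close>

theorem theorem3p5:
  fixes scl :: "'f::field \<Rightarrow> 'a::ab_group_add \<Rightarrow> 'a"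
    and mul :: "'a \<Rightarrow> 'a \<Rightarrow> 'a"
    and Basis :: "'a set"
    and m n :: nat
    and R V :: "('a \<Rightarrow> 'a) set"
    and c :: "'f ncpoly"
  assumes "nonassoc_algebra scl mul"
    and "finite_dimensional_vector_space scl Basis"
    and "simple_algebra scl mul"
    and "vector_space.dim scl (UNIV :: 'a set) = m"
    and "V = mult_space scl mul"
    and "R = mult_algebra scl mul"
    and "multilinear n c"
    and "central_polynomial scl R R c"
  shows "(\<exists>f. central_polynomial scl R V f \<and> total_degree f \<le> n * (4 * m\<^sup>2 - m + 1)) \<and>
    (lie_algebra mul \<or> jordan_algebra mul \<longrightarrow>
      (\<exists>f. central_polynomial scl R V f \<and> total_degree f \<le> n * (m\<^sup>2 - m + 1)))"
proof -
  interpret nonassoc_algebra scl mul by fact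
  interpret fin: finite_dimensional_vector_space scl Basis by fact
  interpret endo: vector_space "fun_scale scl"
    by (rule vector_space_fun_scale) (rule vector_space_axioms)
  have V: "V \<subseteq> End_space scl" "0 \<in> V"
    using mult_space_subset_End_space endo.span_zero by (simp_all add: assms(5) mult_space_def)
  \<comment> \<open>Both bounds reduce to a choice of an independent set \<open>B\<close> of
    multiplications: the larger \<open>B\<close>, the smaller the degree.\<close>
  have main: "\<exists>f. central_polynomial scl R V f \<and> total_degree f \<le> n * D"
    if B: "B \<subseteq> V" "finite B" "endo.independent B" and D: "m\<^sup>2 - card B + 1 \<le> D" for B D
  proof -
    have "finite S \<and> card S \<le> m\<^sup>2" if "S \<subseteq> End_space scl" "endo.independent S" for S
      using fin.card_independent_End_le[OF that] assms(4) by simp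
    from prods_stabilize[OF B V(1) this] obtain k where
      k: "1 \<le> k" "k \<le> m\<^sup>2 - card B + 1" "prods V (Suc k) \<subseteq> endo.span (prods V k)"
      by blast
    obtain f where "central_polynomial scl R V f" "total_degree f \<le> n * k"
      using central_polynomial_on_generators[OF V _ assms(7,8) k(1,3)] assms(5,6)
      by (auto simp: mult_algebra_def)
    moreover have "n * k \<le> n * D"
      using k(2) D by (intro mult_le_mono2) linarith
    ultimately show ?thesis
      using le_trans by blast
  qed
  \<comment> \<open>This gives m^2 + 1 at most 4 m^2 - m + 1, so the empty set serves as
    \<open>B\<close>.\<close>
  have "m \<le> m * m"
    by (cases m) simp_all
  then have "m\<^sup>2 - card {} + 1 \<le> 4 * m\<^sup>2 - m + 1"
    unfolding power2_eq_square by linarith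
  then have general: "\<exists>f. central_polynomial scl R V f \<and> total_degree f \<le> n * (4 * m\<^sup>2 - m + 1)"
    by (intro main[of "{}"]) (simp_all add: endo.independent_empty)
  have "\<exists>f. central_polynomial scl R V f \<and> total_degree f \<le> n * (m\<^sup>2 - m + 1)"
    if LJ: "lie_algebra mul \<or> jordan_algebra mul"
  proof -
    have inj: "inj mul"
      by (rule left_mult_inj[OF assms(3) LJ])
    \<comment> \<open>Left multiplication depends linearly on the element, so injectivity carries
      \<open>Basis\<close> to m independent multiplications.\<close>
    interpret L: Vector_Spaces.linear scl "fun_scale scl" mul
    proof
      fix a b s
      have "(\<lambda>a. mul a x) \<in> End_space scl" for x
        using linear_right_mult by (simp add: End_space_def)
      then show "mul (a + b) = mul a + mul b" "mul (scl s a) = fun_scale scl s (mul a)"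
        by (auto simp: End_space_iff fun_scale_def)
    qed
    have "endo.independent (mul ` Basis)"
      by (intro L.independent_injective_image fin.independent_Basis inj_on_subset[OF inj subset_UNIV])
    moreover have "mul ` Basis \<subseteq> V"
      unfolding assms(5) mult_space_def by (rule subset_trans[OF _ endo.span_superset]) auto
    moreover have "card (mul ` Basis) = m"
      using card_image[OF inj_on_subset[OF inj subset_UNIV], of Basis] assms(4) fin.dim_UNIV by simp
    ultimately show ?thesis
      using main[of "mul ` Basis" "m\<^sup>2 - m + 1"] fin.finite_Basis by simp
  qed
  with general show ?thesis
    by blast
qed

end
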